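(* For any prime $p$ we have $$\sum_{k=1}^{p-1}\frac{2^k}{k}\binom{3k}{k}\equiv 0\pmod p.$$
   Context: Congruences modulo $p$ between rational numbers whose denominators are prime to $p$ are understood in the ring of rationals with denominator prime to $p$ (i.e. $a\equiv b \pmod p$ means that $a-b$ is $p$ times such a rational). *)

theory Defs
  imports Complex_Main "HOL-Computational_Algebra.Primes"
begin

(* quotient_of returns the fraction in lowest terms with positive denominator. *)
definition p_integral_rats :: "nat \<Rightarrow> rat set" where
  "p_integral_rats p = {x. coprime (snd (quotient_of x)) (int p)}"

(* Congruence modulo p in the ring p_integral_rats p. The library's cong is not usable here:
   on the field of rationals, mod is trivial. *)
definition rat_cong :: "rat \<Rightarrow> rat \<Rightarrow> nat \<Rightarrow> bool" where
  "rat_cong a b p \<longleftrightarrow> a \<in> p_integral_rats p \<and> b \<in> p_integral_rats p \<and>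
     (\<exists>c \<in> p_integral_rats p. a - b = of_nat p * c)"

end

theory Submission
  imports Defs "HOL-Number_Theory.Cong" "HOL-Computational_Algebra.Polynomial"
begin

text \<open>
  Let \<open>p\<close> be an odd prime. Since \<open>1/k\<close> is congruent to \<open>(-1)^(k-1) C(p,k)/p\<close> modulo \<open>p\<close> for
  \<open>0 < k < p\<close>, it suffices that the sum of \<open>C(p,k) (-2)^k C(3k,k)\<close> over these \<open>k\<close> is divisible by
  \<open>p^2\<close>. Over all \<open>0 \<le> k \<le> p\<close> the sum is the coefficient of \<open>x^p\<close> in \<open>(x - 2(1+x)^3)^p\<close>. The
  argument 2 is special because this cubic factors: \<open>x - 2(1+x)^3 = -(x+2)(x^2 + (1+x)^2)\<close>.
  Expanding the power of the quadratic factor binomially shows that the coefficient is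
  \<open>1 - 3 * 2^p\<close> modulo \<open>p^2\<close>, which is also the contribution of \<open>k = 0\<close> and \<open>k = p\<close>,
  as \<open>C(3p,p)\<close> is congruent to 3 modulo \<open>p^2\<close>.
\<close>

subsection \<open>Binomial coefficients modulo primes\<close>

text \<open>By absorption \<open>k * C(np,k) = np * C(np-1,k-1)\<close>, and \<open>p\<close> does
  not divide \<open>k\<close>.\<close>

lemma prime_dvd_mult_choose:
  fixes p :: nat
  assumes "prime p" "0 < k" "k < p"
  shows "p dvd (n * p) choose k"
proof -
  have "p dvd k * ((n * p) choose k)"
    using assms(2) by (simp add: times_binomial_minus1_eq)
  with assms show ?thesis
    by (auto simp: prime_dvd_mult_iff dest: dvd_imp_le)
qed

text \<open>Serves for binomial and Vandermonde sums modulo \<open>p\<close> and modulo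
  \<open>p^2\<close> alike, hence the arbitrary modulus \<open>m\<close>.\<close>

lemma cong_sum_end_terms:
  fixes f :: "nat \<Rightarrow> int"
  assumes "0 < n" and "\<And>i. 0 < i \<Longrightarrow> i < n \<Longrightarrow> m dvd f i"
  shows "[(\<Sum>i\<le>n. f i) = f 0 + f n] (mod m)"
proof -
  have "(\<Sum>i\<le>n. f i) = f 0 + f n + (\<Sum>i\<in>{0<..<n}. f i)"
  proof -
    have "{..n} = insert 0 (insert n {0<..<n})" using assms(1) by auto
    then show ?thesis using assms(1) by simp
  qed
  moreover have "m dvd (\<Sum>i\<in>{0<..<n}. f i)"
    by (rule dvd_sum) (use assms(2) in auto)
  ultimately show ?thesis by (simp add: cong_iff_dvd_diff)
qed

text \<open>Vandermonde for \<open>np + p\<close>: each inner term is a product of two binomials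
  divisible by \<open>p\<close>, so modulo \<open>p^2\<close> passing from \<open>n\<close> to
  \<open>n + 1\<close> adds exactly 1.\<close>

lemma choose_mult_prime_cong:
  assumes "prime p"
  shows "[int ((n * p) choose p) = int n] (mod (int p)\<^sup>2)"
proof (induction n)
  case 0
  then show ?case using assms by (simp add: binomial_eq_0 prime_gt_0_nat)
next
  case (Suc n)
  have p: "0 < p" using assms by (simp add: prime_gt_0_nat)
  have "int ((Suc n * p) choose p) = (\<Sum>k\<le>p. int ((p choose k) * ((n * p) choose (p - k))))"
    by (simp add: add.commute vandermonde flip: of_nat_sum del: of_nat_mult)
  also have "[\<dots> = int ((p choose 0) * ((n * p) choose (p - 0))) + int ((p choose p) * ((n * p) choose (p - p)))]
      (mod (int p)\<^sup>2)"
  proof (rule cong_sum_end_terms[OF p])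
    fix i assume "0 < i" "i < p"
    then have "p * p dvd (p choose i) * ((n * p) choose (p - i))"
      using assms prime_dvd_mult_choose[of p i 1] prime_dvd_mult_choose[of p "p - i" n]
      by (intro mult_dvd_mono) auto
    then show "(int p)\<^sup>2 dvd int ((p choose i) * ((n * p) choose (p - i)))"
      by (metis of_nat_dvd_iff of_nat_mult power2_eq_square)
  qed
  also have "int ((p choose 0) * ((n * p) choose (p - 0))) + int ((p choose p) * ((n * p) choose (p - p)))
      = int ((n * p) choose p) + 1" by simp
  also have "[\<dots> = int n + 1] (mod (int p)\<^sup>2)"
    by (intro cong_add Suc.IH cong_refl)
  finally show ?case by (simp add: add.commute)
qed

text \<open>In the Vandermonde sum the inner terms vanish modulo \<open>p\<close>, and the term at 0
  is \<open>C(r,p) = 0\<close> because \<open>r < p\<close>.\<close>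

lemma choose_prime_add_cong:
  assumes "prime p" "r < p"
  shows "[int ((p + r) choose p) = 1] (mod (int p))"
proof -
  have p: "0 < p" using assms by simp
  have "int ((p + r) choose p) = (\<Sum>k\<le>p. int ((p choose k) * (r choose (p - k))))"
    by (simp only: vandermonde flip: of_nat_sum)
  also have "[\<dots> = int ((p choose 0) * (r choose (p - 0))) + int ((p choose p) * (r choose (p - p)))]
      (mod (int p))"
    by (rule cong_sum_end_terms[OF p])
       (use assms prime_dvd_mult_choose[of p _ 1] in \<open>auto simp del: of_nat_mult\<close>)
  finally show ?thesis using assms by (simp add: binomial_eq_0)
qed

text \<open>By Pascal's rule neighbouring entries of row \<open>p - 1\<close> add up to an inner
  entry of row \<open>p\<close>, which is 0 modulo \<open>p\<close>; so the signs alternate.\<close>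

lemma choose_pred_prime_cong:
  assumes "prime p" "k < p"
  shows "[int ((p - 1) choose k) = (-1) ^ k] (mod (int p))"
  using assms(2)
proof (induction k)
  case (Suc k)
  have "p choose Suc k = (p - 1 choose k) + (p - 1 choose Suc k)"
    using Suc.prems by (cases p) auto
  moreover have "int p dvd int (p choose Suc k)"
    using assms Suc.prems prime_dvd_mult_choose[of p "Suc k" 1] by simp
  ultimately have "[int (p - 1 choose k) + int (p - 1 choose Suc k) = 0] (mod int p)"
    by (simp add: cong_0_iff)
  from cong_diff[OF this Suc.IH] Suc.prems show ?case by simp
qed auto

text \<open>By symmetry the lower half of an odd row has half the row sum; the entry 1 at
  \<open>j = 0\<close> is then removed.\<close>

lemma two_mult_half_row_sum:
  "2 * (\<Sum>j=1..m. int ((2 * m + 1) choose j)) = 2 ^ (2 * m + 1) - 2"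
proof -
  have "int (\<Sum>j\<le>m. ((2 * m + 1) choose j)) = 2 ^ (2 * m)"
    unfolding binomial_r_part_sum by simp
  moreover have "{..m} = insert 0 {1..m}" by auto
  ultimately show ?thesis by simp
qed

subsection \<open>The coefficient of the polynomial power\<close>

lemma coeff_one_plus_X_power:
  "coeff ([:1, 1:] ^ n :: int poly) k = int (n choose k)"
proof (cases "k \<le> n")
  case True
  then show ?thesis by (subst coeff_linear_poly_power) auto
next
  case False
  then have "degree ([:1, 1:] ^ n :: int poly) < k"
    by (simp add: degree_linear_power)
  with False show ?thesis by (simp add: coeff_eq_0 binomial_eq_0)
qed

text \<open>The \<open>k\<close>-th binomial term is a multiple of
  \<open>x^(n-k) (1+x)^(3k)\<close>, so its coefficient at \<open>x^n\<close> is read off at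
  \<open>x^k\<close> in \<open>(1+x)^(3k)\<close>.\<close>

lemma coeff_X_minus_cube_power:
  fixes c :: int
  shows "coeff (([:0, 1:] + smult c ([:1, 1:] ^ 3)) ^ n) n
    = (\<Sum>k\<le>n. int (n choose k) * c ^ k * int ((3 * k) choose k))"
proof -
  have X: "[:0, 1:] = monom (1::int) 1" by (simp add: monom_altdef)
  have "([:0, 1:] + smult c ([:1, 1:] ^ 3)) ^ n
    = (\<Sum>k\<le>n. monom (int (n choose k) * c ^ k) (n - k) * [:1, 1:] ^ (3 * k))"
    unfolding X by (subst add.commute, subst binomial_ring)
       (auto intro!: sum.cong simp: smult_power monom_power of_nat_poly smult_monom mult_ac
         simp flip: power_mult mult_smult_left)
  then show ?thesis
    by (auto simp: coeff_sum coeff_monom_mult coeff_one_plus_X_power intro!: sum.cong)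
qed

lemma coeff_linear_power_mult_one_plus_X_power:
  fixes a :: int
  assumes "k \<le> n"
  shows "coeff ([:a, 1:] ^ n * [:1, 1:] ^ r) k
    = (\<Sum>i\<le>k. int (n choose i) * a ^ (n - i) * int (r choose (k - i)))"
  unfolding coeff_mult coeff_one_plus_X_power
  by (rule sum.cong) (use assms in \<open>auto simp: coeff_linear_poly_power\<close>)

text \<open>Expanding the quadratic factor, the power \<open>x^(2j)\<close> shifts the coefficient
  index down by \<open>2j\<close>. Terms with \<open>2j > n\<close> contribute nothing, which for
  odd \<open>n\<close> leaves \<open>j \<le> m\<close>.\<close>

lemma coeff_factored_cubic_power:
  fixes a :: int
  assumes "n = 2 * m + 1"
  shows "coeff (([:a, 1:] * (monom 1 2 + [:1, 1:]\<^sup>2)) ^ n) n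
    = (\<Sum>j\<le>m. int (n choose j) * coeff ([:a, 1:] ^ n * [:1, 1:] ^ (2 * (n - j))) (n - 2 * j))"
proof -
  have "([:a, 1:] * (monom 1 2 + [:1, 1:]\<^sup>2)) ^ n
      = [:a, 1:] ^ n * (\<Sum>j\<le>n. of_nat (n choose j) * monom 1 2 ^ j * ([:1, 1:]\<^sup>2) ^ (n - j))"
    by (simp only: power_mult_distrib binomial_ring)
  also have "\<dots>
      = (\<Sum>j\<le>n. monom (int (n choose j)) (2 * j) * ([:a, 1:] ^ n * [:1, 1:] ^ (2 * (n - j))))"
    unfolding sum_distrib_left
  proof (rule sum.cong[OF refl])
    fix j
    have "of_nat (n choose j) * monom (1::int) 2 ^ j = monom (int (n choose j)) (2 * j)"
      by (simp add: monom_power of_nat_poly smult_monom)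
    then show "[:a, 1:] ^ n * (of_nat (n choose j) * monom 1 2 ^ j * ([:1, 1:]\<^sup>2) ^ (n - j))
        = monom (int (n choose j)) (2 * j) * ([:a, 1:] ^ n * [:1, 1:] ^ (2 * (n - j)))"
      by (simp only: power_mult mult.left_commute)
  qed
  finally have "coeff (([:a, 1:] * (monom 1 2 + [:1, 1:]\<^sup>2)) ^ n) n
      = (\<Sum>j\<le>n. if n < 2 * j then 0
          else int (n choose j) * coeff ([:a, 1:] ^ n * [:1, 1:] ^ (2 * (n - j))) (n - 2 * j))"
    by (simp only: coeff_sum coeff_monom_mult)
  also have "\<dots> = (\<Sum>j\<le>m. int (n choose j) * coeff ([:a, 1:] ^ n * [:1, 1:] ^ (2 * (n - j))) (n - 2 * j))"
    by (rule sum.mono_neutral_cong_right) (use assms in auto)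
  finally show ?thesis .
qed

section \<open>Evaluation of the coefficients modulo \<open>p\<close> and \<open>p^2\<close>\<close>

lemma two_power_prime_cong:
  assumes "prime p"
  shows "[2 ^ p = 2] (mod int p)"
proof -
  have p: "0 < p" using assms by (simp add: prime_gt_0_nat)
  have "(2 :: int) ^ p = (\<Sum>k\<le>p. int (p choose k))"
    by (simp flip: of_nat_sum add: choose_row_sum)
  also have "[\<dots> = int (p choose 0) + int (p choose p)] (mod int p)"
    by (rule cong_sum_end_terms[OF p]) (use assms prime_dvd_mult_choose[of p _ 1] in auto)
  finally show ?thesis by simp
qed

text \<open>This is the term \<open>j = 0\<close> of the expansion, whose weight
  \<open>C(p,0) = 1\<close> brings no factor \<open>p\<close>; it is therefore needed modulo
  \<open>p^2\<close>.\<close>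

lemma coeff_linear_times_one_plus_X_power_cong:
  assumes "prime p"
  shows "[coeff ([:2, 1:] ^ p * [:1, 1:] ^ (2 * p)) p = 2 * 2 ^ p + 1] (mod (int p)\<^sup>2)"
proof -
  have p: "0 < p" using assms by (simp add: prime_gt_0_nat)
  define f where "f i = int (p choose i) * 2 ^ (p - i) * int ((2 * p) choose (p - i))" for i
  have "coeff ([:2, 1:] ^ p * [:1, 1:] ^ (2 * p)) p = (\<Sum>i\<le>p. f i)"
    unfolding f_def by (rule coeff_linear_power_mult_one_plus_X_power) simp
  also have "[\<dots> = f 0 + f p] (mod (int p)\<^sup>2)"
  proof (rule cong_sum_end_terms[OF p])
    fix i assume i: "0 < i" "i < p"
    then have "int p dvd int (p choose i)" "int p dvd int ((2 * p) choose (p - i))"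
      using assms prime_dvd_mult_choose[of p i 1] prime_dvd_mult_choose[of p "p - i" 2] by auto
    then show "(int p)\<^sup>2 dvd f i"
      unfolding f_def power2_eq_square by (intro mult_dvd_mono dvd_mult2)
  qed
  also have "f 0 + f p = 2 ^ p * int ((2 * p) choose p) + 1"
    by (simp add: f_def)
  also have "[\<dots> = 2 ^ p * int 2 + 1] (mod (int p)\<^sup>2)"
    by (intro cong_add cong_scalar_left choose_mult_prime_cong assms cong_refl)
  finally show ?thesis by (simp add: mult.commute)
qed

text \<open>Modulo \<open>p\<close> is enough here, since the coefficient will be multiplied by
  \<open>C(p,j)\<close>, itself divisible by \<open>p\<close>.\<close>

lemma coeff_linear_times_one_plus_X_power_below_cong:
  assumes "prime p" "0 < j" "2 * j < p"
  shows "[coeff ([:2, 1:] ^ p * [:1, 1:] ^ (2 * (p - j))) (p - 2 * j) = 2] (mod int p)"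
proof -
  define f where "f i = int (p choose i) * 2 ^ (p - i) * int ((2 * (p - j)) choose (p - 2 * j - i))" for i
  have "coeff ([:2, 1:] ^ p * [:1, 1:] ^ (2 * (p - j))) (p - 2 * j) = (\<Sum>i\<le>p - 2 * j. f i)"
    unfolding f_def by (rule coeff_linear_power_mult_one_plus_X_power) simp
  also have "\<dots> = f 0 + (\<Sum>i\<in>{0<..p - 2 * j}. f i)"
  proof -
    have "{..p - 2 * j} = insert 0 {0<..p - 2 * j}" by auto
    then show ?thesis by simp
  qed
  also have "[\<dots> = f 0 + 0] (mod int p)"
  proof -
    have "int p dvd (\<Sum>i\<in>{0<..p - 2 * j}. f i)"
    proof (rule dvd_sum)
      fix i assume "i \<in> {0<..p - 2 * j}"
      then have "int p dvd int (p choose i)"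
        using assms prime_dvd_mult_choose[of p i 1] by auto
      then show "int p dvd f i" unfolding f_def by (intro dvd_mult2)
    qed
    then show ?thesis by (intro cong_add cong_refl) (simp add: cong_0_iff)
  qed
  \<comment> \<open>Symmetry turns the lower index \<open>p - 2j\<close> into \<open>p\<close>,
    giving the shape \<open>C(p+r,p)\<close> with \<open>r = p - 2j < p\<close>.\<close>
  also have "f 0 + 0 = 2 ^ p * int ((p + (p - 2 * j)) choose p)"
  proof -
    have "2 * (p - j) = p + (p - 2 * j)" using assms by simp
    then show ?thesis
      using binomial_symmetric[of p "p + (p - 2 * j)"] by (simp add: f_def)
  qed
  also have "[\<dots> = 2 * 1] (mod int p)"
    using assms by (intro cong_mult two_power_prime_cong choose_prime_add_cong) auto
  finally show ?thesis by simp
qed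

lemma alternating_choose_sum_cong:
  assumes "prime p" "odd p"
  shows "[(\<Sum>k\<le>p. int (p choose k) * (-2) ^ k * int ((3 * k) choose k)) = 1 - 3 * 2 ^ p]
    (mod (int p)\<^sup>2)"
proof -
  obtain m where m: "p = 2 * m + 1" using assms(2) by (elim oddE)
  define A where "A j = coeff ([:2, 1:] ^ p * [:1, 1:] ^ (2 * (p - j)) :: int poly) (p - 2 * j)" for j
  have factor: "[:0, 1:] + smult (-2) ([:1, 1:] ^ 3) = - ([:2, 1:] * (monom 1 2 + [:1, 1:]\<^sup>2) :: int poly)"
    by (simp add: eval_nat_numeral monom_Suc monom_0)
  have "(\<Sum>k\<le>p. int (p choose k) * (-2) ^ k * int ((3 * k) choose k))
      = coeff (([:0, 1:] + smult (-2) ([:1, 1:] ^ 3)) ^ p) p"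
    by (rule coeff_X_minus_cube_power [symmetric])
  also have "\<dots> = - coeff (([:2, 1:] * (monom 1 2 + [:1, 1:]\<^sup>2)) ^ p) p"
    unfolding factor power_minus_odd[OF assms(2)] by (rule coeff_minus)
  also have "\<dots> = - (\<Sum>j\<le>m. int (p choose j) * A j)"
    unfolding A_def coeff_factored_cubic_power[OF m] ..
  also have "\<dots> = - (A 0 + (\<Sum>j=1..m. int (p choose j) * A j))"
  proof -
    have "{..m} = insert 0 {1..m}" by auto
    then show ?thesis by simp
  qed
  \<comment> \<open>For \<open>j > 0\<close>, \<open>C(p,j)\<close> supplies one factor
    \<open>p\<close> and \<open>A j - 2\<close> the other.\<close>
  also have "[\<dots> = - ((2 * 2 ^ p + 1) + (\<Sum>j=1..m. int (p choose j) * 2))] (mod (int p)\<^sup>2)"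
  proof (subst cong_minus_minus_iff, intro cong_add cong_sum)
    show "[A 0 = 2 * 2 ^ p + 1] (mod (int p)\<^sup>2)"
      using coeff_linear_times_one_plus_X_power_cong[OF assms(1)] by (simp add: A_def)
  next
    fix j assume "j \<in> {1..m}"
    then have j: "0 < j" "2 * j < p" using m by auto
    then have "int p dvd int (p choose j)"
      using assms prime_dvd_mult_choose[of p j 1] by simp
    moreover have "int p dvd A j - 2"
      using coeff_linear_times_one_plus_X_power_below_cong[OF assms(1) j] by (simp only: A_def cong_iff_dvd_diff)
    ultimately have "int p * int p dvd int (p choose j) * (A j - 2)" by (rule mult_dvd_mono)
    then show "[int (p choose j) * A j = int (p choose j) * 2] (mod (int p)\<^sup>2)"
      by (simp add: cong_iff_dvd_diff power2_eq_square right_diff_distrib)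
  qed
  also have "(\<Sum>j=1..m. int (p choose j) * 2) = 2 ^ p - 2"
    using two_mult_half_row_sum[of m] by (simp only: m sum_distrib_left mult.commute)
  also have "- ((2 * 2 ^ p + 1) + (2 ^ p - 2)) = 1 - 3 * (2 ^ p :: int)" by simp
  finally show ?thesis .
qed

lemma prime_square_dvd_alternating_choose_sum:
  assumes "prime p" "odd p"
  shows "(int p)\<^sup>2 dvd (\<Sum>k=1..p - 1. int (p choose k) * (-2) ^ k * int ((3 * k) choose k))"
    (is "_ dvd ?S")
proof -
  have p: "0 < p" using assms by (simp add: prime_gt_0_nat)
  have "{..p} = insert 0 (insert p {1..p - 1})" using p by auto
  \<comment> \<open>The term at \<open>k = p\<close> is negative because \<open>p\<close> is
    odd.\<close>
  then have "(\<Sum>k\<le>p. int (p choose k) * (-2) ^ k * int ((3 * k) choose k))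
      = 1 - 2 ^ p * int ((3 * p) choose p) + ?S"
    using p assms(2) by simp
  moreover have "[1 - 2 ^ p * int ((3 * p) choose p) = 1 - 2 ^ p * int 3] (mod (int p)\<^sup>2)"
    by (intro cong_diff cong_scalar_left choose_mult_prime_cong assms cong_refl)
  ultimately have "[?S = (1 - 3 * 2 ^ p) - (1 - 2 ^ p * int 3)] (mod (int p)\<^sup>2)"
    using cong_diff[OF alternating_choose_sum_cong[OF assms]] by fastforce
  then show ?thesis by (simp add: cong_0_iff)
qed

subsection \<open>Rationals with denominator prime to \<open>p\<close>\<close>

text \<open>Any fraction with denominator prime to \<open>p\<close> will do, reduced or not: from
  \<open>a * d = c * b\<close> with \<open>c\<close>, \<open>d\<close> coprime, the reduced
  denominator \<open>d\<close> divides \<open>b\<close>.\<close>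

lemma p_integral_ratsI:
  assumes "b \<noteq> 0" "coprime b (int p)"
  shows "of_int a / of_int b \<in> p_integral_rats p"
proof -
  obtain c d where q: "quotient_of (of_int a / of_int b) = (c, d)" by force
  then have d: "d > 0" "coprime c d" "(of_int a / of_int b :: rat) = of_int c / of_int d"
    by (auto dest: quotient_of_denom_pos quotient_of_coprime quotient_of_div)
  then have "(of_int (a * d) :: rat) = of_int (c * b)"
    using assms by (simp add: field_simps)
  then have "a * d = c * b" by (simp only: of_int_eq_iff)
  then have "d dvd b" using d(2)
    by (metis coprime_commute coprime_dvd_mult_right_iff dvd_triv_right)
  then have "coprime d (int p)" using assms(2) by (meson coprime_divisors dvd_refl)
  then show ?thesis by (simp add: p_integral_rats_def q)
qed

lemma p_integral_ratsE:
  assumes "x \<in> p_integral_rats p"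
  obtains a b where "x = of_int a / of_int b" "b \<noteq> 0" "coprime b (int p)"
proof -
  obtain a b where q: "quotient_of x = (a, b)" by force
  with assms that[of a b] show ?thesis
    by (auto simp: p_integral_rats_def dest: quotient_of_denom_pos quotient_of_div)
qed

lemma p_integral_rats_of_int: "of_int a \<in> p_integral_rats p"
  using p_integral_ratsI[of 1 p a] by simp

lemma p_integral_rats_add:
  assumes "x \<in> p_integral_rats p" "y \<in> p_integral_rats p"
  shows "x + y \<in> p_integral_rats p"
proof -
  obtain a b where x: "x = of_int a / of_int b" "b \<noteq> 0" "coprime b (int p)"
    using assms(1) by (rule p_integral_ratsE)
  obtain c d where y: "y = of_int c / of_int d" "d \<noteq> 0" "coprime d (int p)"
    using assms(2) by (rule p_integral_ratsE)
  have "x + y = of_int (a * d + c * b) / of_int (b * d)"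
    using x y by (simp add: field_simps)
  with x y show ?thesis by (metis coprime_mult_left_iff mult_eq_0_iff p_integral_ratsI)
qed

lemma p_integral_rats_sum:
  "(\<And>i. i \<in> I \<Longrightarrow> f i \<in> p_integral_rats p) \<Longrightarrow> sum f I \<in> p_integral_rats p"
  \<comment> \<open>Membership of 0 covers the empty set and also infinite \<open>I\<close>, where
    the sum is 0 by convention.\<close>
  using p_integral_rats_of_int[of 0 p]
  by (induction I rule: infinite_finite_induct) (auto intro: p_integral_rats_add)

lemma p_integral_rats_div_less_prime:
  assumes "prime p" "0 < k" "k < p"
  shows "of_int a / of_nat k \<in> p_integral_rats p"
proof -
  have "coprime k p"
    using assms by (metis coprime_commute nat_dvd_not_less prime_imp_coprime)
  with p_integral_ratsI[of "int k" p a] assms(2) show ?thesis by simp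
qed

text \<open>The witness \<open>c\<close> alone suffices: multiplying it by \<open>p\<close>
  introduces no new denominator, so \<open>x\<close> is p-integral as well.\<close>

lemma rat_cong_0I:
  assumes "c \<in> p_integral_rats p" "x = of_nat p * c"
  shows "rat_cong x 0 p"
proof -
  obtain a b where c: "c = of_int a / of_int b" "b \<noteq> 0" "coprime b (int p)"
    using assms(1) by (rule p_integral_ratsE)
  have "x = of_int (int p * a) / of_int b" using assms(2) c(1) by simp
  then have "x \<in> p_integral_rats p" using p_integral_ratsI[OF c(2,3)] by metis
  with assms p_integral_rats_of_int[of 0 p] show ?thesis by (auto simp: rat_cong_def)
qed

text \<open>Absorption gives \<open>C(p,k)/p = C(p-1,k-1)/k\<close>, whose numerator is
  \<open>(-1)^(k-1)\<close> modulo \<open>p\<close>. The error is kept as an explicit multiple of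
  \<open>p\<close>, so that exact identities in the rationals can be summed.\<close>

lemma inverse_cong_choose_div_prime:
  assumes "prime p" "0 < k" "k < p"
  shows "\<exists>t. (1 / of_nat k :: rat)
    = of_int ((-1) ^ (k - 1)) * (of_nat (p choose k) / of_nat p) + of_nat p * (of_int t / of_nat k)"
proof -
  have "[int ((p - 1) choose (k - 1)) = (-1) ^ (k - 1)] (mod int p)"
    using assms by (intro choose_pred_prime_cong) auto
  then have "[(-1) ^ (k - 1) * int ((p - 1) choose (k - 1)) = (-1) ^ (k - 1) * (-1) ^ (k - 1)] (mod int p)"
    by (rule cong_scalar_left)
  then have "int p dvd 1 - (-1) ^ (k - 1) * int ((p - 1) choose (k - 1))"
    by (simp flip: power_mult_distrib add: cong_iff_dvd_diff dvd_diff_commute)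
  then obtain t where "1 - (-1) ^ (k - 1) * int ((p - 1) choose (k - 1)) = int p * t" ..
  then have "rat_of_int (1 - (-1) ^ (k - 1) * int ((p - 1) choose (k - 1))) = of_int (int p * t)"
    by (rule arg_cong)
  then have t: "1 = of_int ((-1) ^ (k - 1)) * rat_of_nat ((p - 1) choose (k - 1)) + of_nat p * of_int t"
    by (simp add: algebra_simps)
  have "rat_of_nat (k * (p choose k)) = of_nat (p * ((p - 1) choose (k - 1)))"
    using assms by (simp only: times_binomial_minus1_eq)
  then have "rat_of_nat (p choose k) / of_nat p = of_nat ((p - 1) choose (k - 1)) / of_nat k"
    using assms by (simp add: field_simps)
  then have "of_int ((-1) ^ (k - 1)) * (of_nat (p choose k) / of_nat p) + of_nat p * (of_int t / of_nat k)
      = (of_int ((-1) ^ (k - 1)) * rat_of_nat ((p - 1) choose (k - 1)) + of_nat p * of_int t) / of_nat k"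
    by (simp add: add_divide_distrib)
  then show ?thesis unfolding t[symmetric] by metis
qed

theorem theorem1p3:
  fixes p :: nat
  assumes "prime p"
  shows "rat_cong (\<Sum>k = 1..p - 1. 2 ^ k / of_nat k * of_nat ((3 * k) choose k)) 0 p"
proof (cases "p = 2")
  case True
  \<comment> \<open>The sum has the single term \<open>2 * C(3,1) = 6 = 2 * 3\<close>.\<close>
  show ?thesis
    by (rule rat_cong_0I[of "of_int 3"]) (simp_all only: p_integral_rats_of_int, simp add: True)
next
  case False
  then have odd: "odd p" using assms primes_dvd_imp_eq two_is_prime_nat by blast
  have p: "0 < p" using assms by (simp add: prime_gt_0_nat)
  have "\<forall>k\<in>{1..p - 1}. \<exists>t. (1 / of_nat k :: rat)
      = of_int ((-1) ^ (k - 1)) * (of_nat (p choose k) / of_nat p) + of_nat p * (of_int t / of_nat k)"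
    using assms p by (intro ballI inverse_cong_choose_div_prime) auto
  then obtain t where t: "\<And>k. k \<in> {1..p - 1} \<Longrightarrow> (1 / of_nat k :: rat)
      = of_int ((-1) ^ (k - 1)) * (of_nat (p choose k) / of_nat p) + of_nat p * (of_int (t k) / of_nat k)"
    by metis
  obtain N where N: "(\<Sum>k=1..p - 1. int (p choose k) * (-2) ^ k * int ((3 * k) choose k)) = (int p)\<^sup>2 * N"
    using prime_square_dvd_alternating_choose_sum[OF assms odd] ..
  \<comment> \<open>Collects the errors made in replacing \<open>1/k\<close>, with their common
    factor \<open>p\<close> taken out.\<close>
  define c where "c = (\<Sum>k=1..p - 1. rat_of_int (t k * 2 ^ k * int ((3 * k) choose k)) / of_nat k)"
  have "(\<Sum>k=1..p - 1. 2 ^ k / of_nat k * rat_of_nat ((3 * k) choose k))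
      = (\<Sum>k=1..p - 1. - (of_int (int (p choose k) * (-2) ^ k * int ((3 * k) choose k)) / of_nat p)
          + of_nat p * (of_int (t k * 2 ^ k * int ((3 * k) choose k)) / of_nat k))"
  proof (rule sum.cong[OF refl])
    fix k assume k: "k \<in> {1..p - 1}"
    \<comment> \<open>The exponent \<open>k - 1\<close> of the sign differs from \<open>k\<close> by
      one, whence the global minus sign before the alternating sum.\<close>
    have "(-2) ^ k = - ((-1) ^ (k - 1) * 2 ^ k :: rat)"
      using k by (cases k) (auto simp: power_minus[of "2::rat"])
    moreover have "2 ^ k / of_nat k * rat_of_nat ((3 * k) choose k)
        = (1 / of_nat k) * (2 ^ k * rat_of_nat ((3 * k) choose k))" by simp
    ultimately show "2 ^ k / of_nat k * rat_of_nat ((3 * k) choose k)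
      = - (of_int (int (p choose k) * (-2) ^ k * int ((3 * k) choose k)) / of_nat p)
          + of_nat p * (of_int (t k * 2 ^ k * int ((3 * k) choose k)) / of_nat k)"
      unfolding t[OF k] by (simp add: algebra_simps)
  qed
  also have "\<dots> = - (of_int (\<Sum>k=1..p - 1. int (p choose k) * (-2) ^ k * int ((3 * k) choose k)) / of_nat p)
      + of_nat p * c"
    unfolding c_def of_int_sum sum_divide_distrib sum_distrib_left sum.distrib sum_negf ..
  \<comment> \<open>Of the factor \<open>p^2\<close> one \<open>p\<close> cancels against the
    denominator; the other remains.\<close>
  also have "\<dots> = of_nat p * (of_int (- N) + c)"
    unfolding N using p by (simp add: power2_eq_square algebra_simps)
  finally have "(\<Sum>k=1..p - 1. 2 ^ k / of_nat k * rat_of_nat ((3 * k) choose k)) = of_nat p * (of_int (- N) + c)" .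
  moreover have "of_int (- N) + c \<in> p_integral_rats p"
    unfolding c_def using assms p
    by (intro p_integral_rats_add p_integral_rats_of_int p_integral_rats_sum p_integral_rats_div_less_prime) auto
  ultimately show ?thesis by (rule rat_cong_0I[rotated])
qed

end
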